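(* Let $m>2$ and $q>0$ be integers such that $m$ is even or $q$ is odd. Then for any prime $p>mq$, $$\sum_{k=0}^{p-1}(-1)^{km}\binom{p/m-q}{k}^m\equiv 0\pmod{p^3}.$$
   Context: For a rational number $x$ and an integer $k\ge 0$, $\binom{x}{k}=\frac{x(x-1)\cdots(x-k+1)}{k!}$ (with $\binom{x}{0}=1$); here $x=p/m-q$ is a rational number. Congruences are understood in the ring of $p$-adic integers (equivalently, in the ring $\mathbb{Z}_{(p)}$ of rational numbers with denominator prime to $p$): $a\equiv b\pmod{p^n}$ means that $(a-b)/p^n$ is $p$-integral. *)

theory Defs
  imports Complex_Main "HOL-Computational_Algebra.Primes"
begin

text \<open>
  The ring of rationals with denominator prime to p. The function \<^const>\<open>quotient_of\<close> returns
  numerator and denominator in lowest terms, so its second component is the reduced denominator.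
\<close>

definition p_integral :: "nat \<Rightarrow> rat \<Rightarrow> bool"
  where "p_integral p x \<longleftrightarrow> coprime (snd (quotient_of x)) (int p)"

definition p_integral_cong :: "nat \<Rightarrow> nat \<Rightarrow> rat \<Rightarrow> rat \<Rightarrow> bool"
  where "p_integral_cong p n a b \<longleftrightarrow> p_integral p ((a - b) / of_nat p ^ n)"

end

theory Submission
  imports Defs "HOL-Computational_Algebra.Polynomial"
begin

text \<open>
  Put \<open>q = r + 1\<close>, \<open>N = p - q\<close> and \<open>b k = (k + r choose r)\<close>. Up to sign, the \<open>k\<close>-th binomial coefficient
  is the product over \<open>i < k\<close> of \<open>(q + i - p/m) / (i + 1)\<close>. For \<open>N < k < p\<close> it is divisible by \<open>p\<close>, so its
  \<open>m\<close>-th power vanishes modulo \<open>p\<^sup>3\<close>. For \<open>k \<le> N\<close> its \<open>m\<close>-th power is, modulo \<open>p\<^sup>3\<close>,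
  \<open>b k ^ m * (B k + c p\<^sup>2 H k)\<close> where \<open>B k\<close> is the product of the \<open>1 - p/(q + i)\<close>, \<open>H k\<close> is the sum of
  the \<open>1/(q + i)\<^sup>2\<close>, and \<open>c = (m choose 2)/m\<^sup>2\<close>.

  Since \<open>b k * B k = (-1) ^ k * (N choose k)\<close> and \<open>b\<close> is a polynomial of degree \<open>r\<close>, the sum of
  \<open>b k ^ m * B k\<close> is an \<open>N\<close>-th finite difference of a polynomial of degree \<open>(m - 1) r < N\<close>, hence zero.
  The sum of \<open>b k ^ m * H k\<close> need only vanish modulo \<open>p\<close>. Under \<open>k \<mapsto> N - k\<close> the value \<open>b k\<close> changes
  by the sign \<open>(-1) ^ r\<close>, which is lost in the \<open>m\<close>-th power by the parity hypothesis, while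
  \<open>H k + H (N - k)\<close> is congruent to a constant plus the sum of \<open>1/(k + i)\<^sup>2\<close> for \<open>1 \<le> i \<le> r\<close>. As \<open>m > 2\<close>,
  these denominators divide \<open>b k ^ (m - 1)\<close> as polynomials, so the sum is again a finite difference modulo \<open>p\<close>.
\<close>

section \<open>Arithmetic of p-integral rationals\<close>

text \<open>The reduced denominator divides every other denominator of the same rational, so any
  single fraction with denominator prime to \<open>p\<close> witnesses integrality. The closure
  proofs can thus work with unreduced fractions.\<close>

lemma p_integral_iff:
  assumes "prime p"
  shows "p_integral p x \<longleftrightarrow> (\<exists>a b. x = of_int a / of_int b \<and> \<not> int p dvd b)"
proof
  assume "p_integral p x"
  obtain a b where ab: "quotient_of x = (a, b)" by fastforce
  have "coprime (int p) b"
    using \<open>p_integral p x\<close> ab by (simp add: p_integral_def coprime_commute)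
  then have "\<not> int p dvd b"
    using assms by (metis coprime_common_divisor dvd_refl not_prime_unit prime_nat_int_transfer)
  then show "\<exists>a b. x = of_int a / of_int b \<and> \<not> int p dvd b"
    using quotient_of_div[OF ab] by blast
next
  assume "\<exists>a b. x = of_int a / of_int b \<and> \<not> int p dvd b"
  then obtain a b where x: "x = of_int a / of_int b" and b: "\<not> int p dvd b" by blast
  obtain c d where cd: "quotient_of x = (c, d)" by fastforce
  have d: "d > 0" "coprime c d" "x = of_int c / of_int d"
    using cd quotient_of_denom_pos quotient_of_coprime quotient_of_div by blast+
  have "b \<noteq> 0" using b by auto
  then have "(of_int (a * d) :: rat) = of_int (c * b)"
    using x d by (simp add: field_simps)
  then have "a * d = c * b" by (simp only: of_int_eq_iff)
  then have "d dvd b"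
    using d(2) by (metis coprime_commute coprime_dvd_mult_right_iff dvd_triv_right)
  then have "\<not> int p dvd d" using b dvd_trans by blast
  then have "coprime (int p) d"
    using assms by (intro prime_imp_coprime) simp_all
  then show "p_integral p x"
    using cd by (simp add: p_integral_def coprime_commute)
qed

context
  fixes p :: nat
  assumes prime: "prime p"
begin

lemma p_integral_of_int [simp]: "p_integral p (of_int a)"
  by (simp add: p_integral_def)

lemma p_integral_of_nat [simp]: "p_integral p (of_nat a)"
  using p_integral_of_int[of "int a"] by simp

lemma p_integral_0 [simp]: "p_integral p 0"
  using p_integral_of_int[of 0] by simp

lemma p_integral_1 [simp]: "p_integral p 1"
  using p_integral_of_int[of 1] by simp

lemma p_integral_mult [intro]:
  assumes "p_integral p x" "p_integral p y"
  shows "p_integral p (x * y)"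
proof -
  obtain a b c d where "x = of_int a / of_int b" "\<not> int p dvd b"
    "y = of_int c / of_int d" "\<not> int p dvd d"
    using assms p_integral_iff[OF prime] by metis
  moreover from this have "\<not> int p dvd b * d"
    using prime by (simp add: prime_dvd_mult_iff)
  ultimately show ?thesis
    unfolding p_integral_iff[OF prime] by (intro exI[of _ "a * c"] exI[of _ "b * d"]) simp
qed

lemma p_integral_add [intro]:
  assumes "p_integral p x" "p_integral p y"
  shows "p_integral p (x + y)"
proof -
  obtain a b c d where *: "x = of_int a / of_int b" "\<not> int p dvd b"
    "y = of_int c / of_int d" "\<not> int p dvd d"
    using assms p_integral_iff[OF prime] by metis
  then have "\<not> int p dvd b * d" "b \<noteq> 0" "d \<noteq> 0"
    using prime by (auto simp: prime_dvd_mult_iff)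
  then show ?thesis
    unfolding p_integral_iff[OF prime] using *
    by (intro exI[of _ "a * d + c * b"] exI[of _ "b * d"]) (simp add: field_simps)
qed

lemma p_integral_minus [intro]: "p_integral p x \<Longrightarrow> p_integral p (- x)"
  using p_integral_mult[OF p_integral_of_int[of "- 1"]] by fastforce

lemma p_integral_diff [intro]: "p_integral p x \<Longrightarrow> p_integral p y \<Longrightarrow> p_integral p (x - y)"
  using p_integral_add[OF _ p_integral_minus] by fastforce

lemma p_integral_power [intro]: "p_integral p x \<Longrightarrow> p_integral p (x ^ n)"
  by (induction n) auto

lemma p_integral_sum [intro]: "(\<And>i. i \<in> A \<Longrightarrow> p_integral p (f i)) \<Longrightarrow> p_integral p (sum f A)"
  by (induction A rule: infinite_finite_induct) auto

lemma p_integral_prod [intro]: "(\<And>i. i \<in> A \<Longrightarrow> p_integral p (f i)) \<Longrightarrow> p_integral p (prod f A)"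
  by (induction A rule: infinite_finite_induct) auto

lemma p_integral_divide_nat [intro]:
  assumes "p_integral p x" "0 < n" "n < p"
  shows "p_integral p (x / of_nat n)"
proof -
  have "\<not> int p dvd int n"
    using assms by (auto dest: dvd_imp_le)
  then have "p_integral p (1 / of_nat n)"
    unfolding p_integral_iff[OF prime] by (intro exI[of _ 1] exI[of _ "int n"]) simp
  from p_integral_mult[OF assms(1) this] show ?thesis by simp
qed

lemma p_integral_cong_iff:
  "p_integral_cong p n x y \<longleftrightarrow> (\<exists>s. p_integral p s \<and> x = y + of_nat p ^ n * s)"
proof -
  have "of_nat p ^ n \<noteq> (0 :: rat)" using prime by (simp add: prime_gt_0_nat)
  then show ?thesis unfolding p_integral_cong_def
    by (auto simp: field_simps intro!: exI[of _ "(x - y) / of_nat p ^ n"])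
qed

lemma p_integral_cong_refl [simp]: "p_integral_cong p n x x"
  by (simp add: p_integral_cong_def)

lemma p_integral_cong_add:
  "p_integral_cong p n x y \<Longrightarrow> p_integral_cong p n z w \<Longrightarrow> p_integral_cong p n (x + z) (y + w)"
  unfolding p_integral_cong_def using p_integral_add
  by (metis add_diff_add add_divide_distrib)

lemma p_integral_cong_trans:
  "p_integral_cong p n x y \<Longrightarrow> p_integral_cong p n y z \<Longrightarrow> p_integral_cong p n x z"
  unfolding p_integral_cong_def using p_integral_add
  by (metis add_divide_distrib diff_add_cancel add_diff_eq)

text \<open>The difference of the products is x (z - w) + (x - y) w, so integrality is asked of
  \<open>x\<close> and \<open>w\<close>, one factor on each side.\<close>

lemma p_integral_cong_mult:
  assumes "p_integral_cong p n x y" "p_integral_cong p n z w" "p_integral p x" "p_integral p w"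
  shows "p_integral_cong p n (x * z) (y * w)"
proof -
  have "(x * z - y * w) / of_nat p ^ n = x * ((z - w) / of_nat p ^ n) + (x - y) / of_nat p ^ n * w"
    by (simp add: algebra_simps diff_divide_distrib add_divide_distrib)
  then show ?thesis using assms unfolding p_integral_cong_def
    by (metis p_integral_add p_integral_mult)
qed

lemma p_integral_cong_sum:
  "(\<And>i. i \<in> A \<Longrightarrow> p_integral_cong p n (f i) (g i)) \<Longrightarrow> p_integral_cong p n (sum f A) (sum g A)"
  by (induction A rule: infinite_finite_induct) (auto intro: p_integral_cong_add)

lemma p_integral_cong_prod:
  assumes "\<And>i. i \<in> A \<Longrightarrow> p_integral_cong p n (f i) (g i)"
    "\<And>i. i \<in> A \<Longrightarrow> p_integral p (f i)" "\<And>i. i \<in> A \<Longrightarrow> p_integral p (g i)"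
  shows "p_integral_cong p n (prod f A) (prod g A)"
  using assms
  by (induction A rule: infinite_finite_induct) (auto intro!: p_integral_cong_mult)

lemma p_integral_cong_power:
  assumes "p_integral_cong p n x y" "p_integral p x" "p_integral p y"
  shows "p_integral_cong p n (x ^ k) (y ^ k)"
  using assms by (induction k) (auto intro!: p_integral_cong_mult)

end

section \<open>Finite differences\<close>

text \<open>Induction on \<open>N\<close> with h = a + X g. The constant a meets the alternating row
  sum, which is 0; the factor k in front of g is absorbed by the binomial coefficient, which leaves
  the previous row and a shifted g of smaller degree.\<close>

lemma alternating_binomial_sum_poly_eq_0:
  fixes h :: "'a :: {comm_ring_1, semiring_no_zero_divisors} poly"
  assumes "degree h < N"
  shows "(\<Sum>k\<le>N. (- 1) ^ k * of_nat (N choose k) * poly h (of_nat k)) = 0"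
  using assms
proof (induction N arbitrary: h)
  case (Suc N)
  obtain a g where h: "h = pCons a g" by (cases h)
  have shift: "(\<Sum>k\<le>Suc N. (- 1) ^ k * of_nat (Suc N choose k) * (of_nat k * poly g (of_nat k)))
      = - of_nat (Suc N) *
        (\<Sum>k\<le>N. (- 1) ^ k * of_nat (N choose k) * poly (pcompose g [:1, 1:]) (of_nat k))"
  proof -
    have "(- 1) ^ Suc k * of_nat (Suc N choose Suc k) * (of_nat (Suc k) * poly g (of_nat (Suc k)))
      = - of_nat (Suc N) * ((- 1) ^ k * of_nat (N choose k) * poly (pcompose g [:1, 1:]) (of_nat k))"
      for k
    proof -
      have "of_nat (Suc N choose Suc k) * of_nat (Suc k) = (of_nat (Suc N) * of_nat (N choose k) :: 'a)"
        using Suc_times_binomial[of k N] by (metis mult.commute of_nat_mult)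
      then have "(- 1) ^ Suc k * of_nat (Suc N choose Suc k) * (of_nat (Suc k) * poly g (of_nat (Suc k)))
        = - ((- 1) ^ k * (of_nat (Suc N) * of_nat (N choose k)) * poly g (of_nat (Suc k)))"
        by (metis (no_types, opaque_lifting) mult.assoc mult.left_commute mult_minus1 power_Suc mult_minus_left)
      then show ?thesis by (simp add: poly_pcompose algebra_simps)
    qed
    \<comment> \<open>The term at k = 0 carries the factor k and drops out, so only the shifted
      terms remain.\<close>
    then show ?thesis
      unfolding sum.atMost_Suc_shift[of _ N] sum_distrib_left by simp
  qed
  have "(\<Sum>k\<le>N. (- 1) ^ k * of_nat (N choose k) * poly (pcompose g [:1, 1:]) (of_nat k)) = 0"
  \<comment> \<open>For \<open>N = 0\<close> the polynomial h is constant and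
    \<open>degree g < N\<close> fails, hence the separate case.\<close>
  proof (cases "g = 0")
    case False
    then have "degree g < N" using Suc.prems h by simp
    moreover have "degree (pcompose g [:1, 1:]) \<le> degree g"
      using degree_pcompose_le[of g "[:1, 1:]"] by simp
    ultimately show ?thesis using Suc.IH by simp
  qed simp
  with shift have "(\<Sum>k\<le>Suc N. (- 1) ^ k * of_nat (Suc N choose k) * (of_nat k * poly g (of_nat k))) = 0"
    by simp
  moreover have "(\<Sum>k\<le>Suc N. (- 1) ^ k * of_nat (Suc N choose k)) = (0 :: 'a)"
    by (rule choose_alternating_sum) simp
  moreover have "(- 1) ^ k * of_nat (Suc N choose k) * poly h (of_nat k)
    = a * ((- 1) ^ k * of_nat (Suc N choose k))
      + (- 1) ^ k * of_nat (Suc N choose k) * (of_nat k * poly g (of_nat k))" for k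
    by (simp add: h algebra_simps del: binomial_Suc_Suc)
  ultimately show ?case
    by (simp only: sum.distrib flip: sum_distrib_left) simp
qed simp


section \<open>Binomial coefficients as polynomials and as products\<close>

definition binom_poly :: "nat \<Rightarrow> rat poly"
  where "binom_poly r = smult (1 / fact r) (\<Prod>i<r. [:of_nat (Suc i), 1:])"

text \<open>For \<open>i < r\<close> this is \<open>binom_poly r\<close> divided by X + i + 1. Its
  square stands for (k + r choose r)^2 / (k + i + 1)^2 while remaining a polynomial in k.\<close>

definition binom_poly_cofactor :: "nat \<Rightarrow> nat \<Rightarrow> rat poly"
  where "binom_poly_cofactor r i = smult (1 / fact r) (\<Prod>l\<in>{..<r} - {i}. [:of_nat (Suc l), 1:])"

text \<open>With one factor per \<open>i < k\<close>, this form can be compared factor by factor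
  with the other products over \<open>i < k\<close>.\<close>

lemma binomial_prod_left:
  "(of_nat (k + r choose r) :: rat) = (\<Prod>i<k. of_nat (Suc r + i) / of_nat (Suc i))"
proof (induction k)
  case (Suc k)
  have sym: "(j + r choose r) = (j + r choose j)" for j
    using binomial_symmetric[of r "j + r"] by simp
  have "Suc k * (Suc k + r choose r) = (Suc r + k) * (k + r choose r)"
    using Suc_times_binomial[of k "k + r"] sym[of k] sym[of "Suc k"] by (simp add: add.commute)
  then have "of_nat (Suc k) * (of_nat (Suc k + r choose r) :: rat)
    = of_nat (Suc r + k) * of_nat (k + r choose r)"
    by (metis of_nat_mult)
  then show ?case
    using Suc by (simp add: field_simps del: of_nat_Suc of_nat_add binomial_Suc_Suc)
qed simp

lemma fact_eq_prod_lessThan: "(fact r :: rat) = (\<Prod>i<r. of_nat (Suc i))"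
  by (induction r) (simp_all add: mult.commute)

text \<open>Exchanging the roles of k and r gives a fixed number r of factors, which exhibits a
  polynomial in k.\<close>

lemma binomial_prod_right:
  "(of_nat (k + r choose r) :: rat) = 1 / fact r * (\<Prod>i<r. of_nat (k + Suc i))"
proof -
  have "(of_nat (k + r choose r) :: rat) = of_nat (r + k choose k)"
    using binomial_symmetric[of r "k + r"] by (simp add: add.commute)
  also have "\<dots> = (\<Prod>i<r. of_nat (Suc k + i) / of_nat (Suc i))"
    by (rule binomial_prod_left)
  finally show ?thesis
    by (simp add: prod_dividef fact_eq_prod_lessThan del: of_nat_Suc)
qed

lemma poly_binom_poly: "poly (binom_poly r) (of_nat k) = of_nat (k + r choose r)"
  by (simp add: binom_poly_def binomial_prod_right poly_prod algebra_simps)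

lemma degree_binom_poly: "degree (binom_poly r) \<le> r"
proof -
  have "degree (\<Prod>i<r. [:rat_of_nat (Suc i), 1:]) \<le> r"
    using degree_prod_sum_le[of "{..<r}" "\<lambda>i. [:rat_of_nat (Suc i), 1:]"] by simp
  then show ?thesis unfolding binom_poly_def by simp
qed

lemma degree_binom_poly_cofactor: "degree (binom_poly_cofactor r i) \<le> r"
proof -
  have "degree (\<Prod>l\<in>{..<r} - {i}. [:rat_of_nat (Suc l), 1:]) \<le> card ({..<r} - {i})"
    using degree_prod_sum_le[of "{..<r} - {i}" "\<lambda>i. [:rat_of_nat (Suc i), 1:]"] by simp
  also have "\<dots> \<le> r"
    using card_mono[of "{..<r}" "{..<r} - {i}"] by simp
  finally show ?thesis unfolding binom_poly_cofactor_def by simp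
qed

lemma poly_binom_poly_cofactor:
  assumes "i < r"
  shows "poly (binom_poly_cofactor r i) (of_nat k) = of_nat (k + r choose r) / of_nat (k + Suc i)"
proof -
  have "(\<Prod>l<r. of_nat (k + Suc l) :: rat)
    = of_nat (k + Suc i) * (\<Prod>l\<in>{..<r} - {i}. of_nat (k + Suc l))"
    using assms by (subst prod.remove[of _ i]) simp_all
  then have "of_nat (k + r choose r) / of_nat (k + Suc i)
    = 1 / fact r * (\<Prod>l\<in>{..<r} - {i}. rat_of_nat (k + Suc l))"
    unfolding binomial_prod_right by (simp add: field_simps del: of_nat_Suc of_nat_add)
  then show ?thesis
    by (simp add: binom_poly_cofactor_def poly_prod algebra_simps)
qed

text \<open>The numerators r + 1 + i of \<open>binomial_prod_left\<close> cancel the denominators of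
  the second product and leave the factors (i - N)/(i + 1) with N = p - r - 1. The identity is
  exact, not merely a congruence.\<close>

lemma binomial_times_falling_prod:
  assumes "r < p"
  shows "of_nat (k + r choose r) * (\<Prod>i<k. 1 - of_nat p / of_nat (Suc r + i) :: rat)
    = (- 1) ^ k * of_nat (p - Suc r choose k)"
proof (induction k)
  case (Suc k)
  let ?N = "p - Suc r"
  have N: "rat_of_nat ?N = of_nat p - of_nat (Suc r)"
    using assms by (simp add: of_nat_diff)
  \<comment> \<open>Going through \<open>gbinomial\<close> makes N - k a rational difference, so the
    recurrence also covers k > N.\<close>
  have "of_nat (Suc k) * rat_of_nat (?N choose Suc k) = (of_nat ?N - of_nat k) * of_nat (?N choose k)"
    using gbinomial_mult_1[of "rat_of_nat ?N" k]
    by (simp add: binomial_gbinomial algebra_simps)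
  then have step: "- (rat_of_nat (?N choose Suc k))
    = rat_of_nat (?N choose k) * ((of_nat (Suc r + k) - of_nat p) / of_nat (Suc k))"
    unfolding N by (simp add: field_simps)
  have "of_nat (Suc k + r choose r) * (\<Prod>i<Suc k. 1 - of_nat p / of_nat (Suc r + i) :: rat)
    = (of_nat (k + r choose r) * (\<Prod>i<k. 1 - of_nat p / of_nat (Suc r + i)))
      * (of_nat (Suc r + k) / of_nat (Suc k) * (1 - of_nat p / of_nat (Suc r + k)))"
    unfolding binomial_prod_left by simp
  also have "of_nat (Suc r + k) / of_nat (Suc k) * (1 - of_nat p / of_nat (Suc r + k))
    = (of_nat (Suc r + k) - of_nat p) / (of_nat (Suc k) :: rat)"
    by (simp add: field_simps del: of_nat_Suc of_nat_add)
  also have "of_nat (k + r choose r) * (\<Prod>i<k. 1 - of_nat p / of_nat (Suc r + i))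
      * ((of_nat (Suc r + k) - of_nat p) / (of_nat (Suc k) :: rat))
    = (- 1) ^ k * (of_nat (?N choose k) * ((of_nat (Suc r + k) - of_nat p) / of_nat (Suc k)))"
    unfolding Suc by (rule mult.assoc)
  also have "\<dots> = (- 1) ^ Suc k * of_nat (?N choose Suc k)"
    unfolding step[symmetric] by simp
  finally show ?case .
qed simp

text \<open>A segment of the harmonic sum of order 2, over the integers from r + 1 to r + k; the
  offset 0 gives the generalized harmonic number.\<close>

definition recip_square_sum :: "nat \<Rightarrow> nat \<Rightarrow> rat"
  where "recip_square_sum r k = (\<Sum>i<k. 1 / of_nat (Suc r + i) ^ 2)"

lemma recip_square_sum_eq_diff:
  "recip_square_sum r k = recip_square_sum 0 (r + k) - recip_square_sum 0 r"
  by (induction k) (simp_all add: recip_square_sum_def)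

section \<open>Congruences for the factors of a summand\<close>

context
  fixes p :: nat
  assumes prime: "prime p"
begin

lemma p_integral_inverse_fact:
  assumes "n < p"
  shows "p_integral p (1 / fact n)"
  using assms
proof (induction n)
  case (Suc n)
  then have "p_integral p (1 / fact n / of_nat (Suc n))"
    by (intro p_integral_divide_nat[OF prime]) simp_all
  then show ?case by (simp add: field_simps)
qed (simp add: prime)

lemma p_integral_recip_square_sum:
  assumes "r + k < p"
  shows "p_integral p (recip_square_sum r k)"
proof -
  have "p_integral p (1 / of_nat (Suc r + i) / of_nat (Suc r + i))" if "i < k" for i
    using that assms by (intro p_integral_divide_nat[OF prime] p_integral_1[OF prime]) simp_all
  then show ?thesis
    unfolding recip_square_sum_def by (intro p_integral_sum[OF prime]) (simp add: power2_eq_square)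
qed

lemma falling_prod_cong_1:
  assumes "r + k < p"
  shows "p_integral_cong p 1 (\<Prod>i<k. 1 - of_nat p / of_nat (Suc r + i)) 1"
    and "p_integral p (\<Prod>i<k. 1 - of_nat p / of_nat (Suc r + i))"
proof -
  have int: "p_integral p (1 / of_nat (Suc r + i))" if "i < k" for i
    using that assms by (intro p_integral_divide_nat[OF prime] p_integral_1[OF prime]) simp_all
  have int': "p_integral p (1 - of_nat p / of_nat (Suc r + i))" if "i < k" for i
    using p_integral_diff[OF prime p_integral_1[OF prime]
        p_integral_mult[OF prime p_integral_of_nat[OF prime, of p] int[OF that]]] by simp
  then show "p_integral p (\<Prod>i<k. 1 - of_nat p / of_nat (Suc r + i))"
    by (intro p_integral_prod[OF prime]) simp
  have "p_integral_cong p 1 (1 - of_nat p / of_nat (Suc r + i)) 1" if "i < k" for i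
    unfolding p_integral_cong_iff[OF prime]
    using p_integral_minus[OF prime int[OF that]]
    by (intro exI[of _ "- (1 / of_nat (Suc r + i))"]) simp
  then have "p_integral_cong p 1 (\<Prod>i<k. 1 - of_nat p / of_nat (Suc r + i)) (\<Prod>i<k. 1)"
    using int' by (intro p_integral_cong_prod[OF prime]) (simp_all add: prime)
  then show "p_integral_cong p 1 (\<Prod>i<k. 1 - of_nat p / of_nat (Suc r + i)) 1" by simp
qed

text \<open>
  Modulo \<open>p\<close> the weight \<open>(k + r choose r)\<close> is an alternating binomial coefficient, so the
  sum is a vanishing finite difference.
\<close>

lemma binomial_weighted_poly_sum_cong_0:
  assumes "r < p" "degree h < p - Suc r"
    and h: "\<And>k. k \<le> p - Suc r \<Longrightarrow> p_integral p (poly h (of_nat k))"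
  shows "p_integral_cong p 1 (\<Sum>k\<le>p - Suc r. of_nat (k + r choose r) * poly h (of_nat k)) 0"
proof -
  let ?N = "p - Suc r"
  let ?B = "\<lambda>k. \<Prod>i<k. 1 - of_nat p / of_nat (Suc r + i) :: rat"
  have "p_integral_cong p 1 (\<Sum>k\<le>?N. of_nat (k + r choose r) * poly h (of_nat k))
    (\<Sum>k\<le>?N. (- 1) ^ k * of_nat (?N choose k) * poly h (of_nat k))"
  proof (rule p_integral_cong_sum[OF prime])
    fix k assume "k \<in> {..?N}"
    then have "r + k < p" using assms(1) by auto
    note B = falling_prod_cong_1[OF this]
    obtain s where s: "p_integral p s" "?B k = 1 + of_nat p * s"
      using B(1) unfolding p_integral_cong_iff[OF prime] by auto
    \<comment> \<open>The missing weight 1 is rewritten as \<open>?B k\<close> - p s.\<close>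
    have "of_nat (k + r choose r) * poly h (of_nat k)
      = of_nat (k + r choose r) * ?B k * poly h (of_nat k)
        + of_nat p ^ 1 * (of_nat (k + r choose r) * poly h (of_nat k) * (- s))"
      unfolding s(2) by (simp add: algebra_simps)
    moreover have "p_integral p (of_nat (k + r choose r) * poly h (of_nat k) * (- s))"
      using h \<open>k \<in> {..?N}\<close> s(1)
      by (intro p_integral_mult[OF prime] p_integral_minus[OF prime] p_integral_of_nat[OF prime]) auto
    ultimately show "p_integral_cong p 1 (of_nat (k + r choose r) * poly h (of_nat k))
      ((- 1) ^ k * of_nat (?N choose k) * poly h (of_nat k))"
      unfolding p_integral_cong_iff[OF prime] binomial_times_falling_prod[OF assms(1)] by blast
  qed
  then show ?thesis using alternating_binomial_sum_poly_eq_0[OF assms(2)] by simp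
qed

section \<open>Reflection of the index k to N - k modulo p\<close>

text \<open>In reverse order the r factors on the left are p - (k + i + 1), each congruent to -(k +
  i + 1).\<close>

lemma binomial_reflect_cong:
  assumes "r < p" "k \<le> p - Suc r"
  shows "p_integral_cong p 1 (of_nat (p - Suc r - k + r choose r)) ((- 1) ^ r * of_nat (k + r choose r))"
proof -
  have "p_integral_cong p 1 (\<Prod>i<r. of_nat (p - (k + Suc i))) (\<Prod>i<r. - of_nat (k + Suc i))"
  proof (rule p_integral_cong_prod[OF prime])
    fix i assume "i \<in> {..<r}"
    then have "rat_of_nat (p - (k + Suc i)) = of_nat p - of_nat (k + Suc i)"
      using assms by (intro of_nat_diff) auto
    then show "p_integral_cong p 1 (of_nat (p - (k + Suc i))) (- of_nat (k + Suc i))"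
      unfolding p_integral_cong_iff[OF prime] by (intro exI[of _ 1]) (simp add: prime)
  qed (auto simp del: of_nat_add of_nat_Suc intro!: p_integral_minus[OF prime] p_integral_of_nat[OF prime])
  then have "p_integral_cong p 1 (1 / fact r * (\<Prod>i<r. of_nat (p - (k + Suc i))))
    (1 / fact r * (\<Prod>i<r. - of_nat (k + Suc i)))"
    using assms(1)
    by (intro p_integral_cong_mult[OF prime] p_integral_prod[OF prime] p_integral_minus[OF prime]
        p_integral_of_nat[OF prime] p_integral_inverse_fact p_integral_cong_refl[OF prime])
  moreover have "(\<Prod>i<r. rat_of_nat (p - Suc r - k + Suc i)) = (\<Prod>i<r. of_nat (p - (k + Suc i)))"
    unfolding prod.nat_diff_reindex[of "\<lambda>i. rat_of_nat (p - Suc r - k + Suc i)" r, symmetric]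
    using assms by (intro prod.cong refl arg_cong[of _ _ of_nat]) auto
  moreover have "(\<Prod>i<r. - rat_of_nat (k + Suc i)) = (- 1) ^ r * (\<Prod>i<r. of_nat (k + Suc i))"
    by (subst prod_uminus) (simp add: power_minus1_even)
  ultimately show ?thesis unfolding binomial_prod_right by (simp add: mult.left_commute)
qed

text \<open>Replacing j by p - j carries the range from r + 1 to p - 1 - k onto the range from k + 1
  to p - r - 1; squaring removes the sign that 1/j acquires modulo p.\<close>

lemma recip_square_sum_reflect_cong:
  assumes "r < p" "k \<le> p - Suc r"
  shows "p_integral_cong p 1 (recip_square_sum r (p - Suc r - k))
    (recip_square_sum 0 (p - Suc r) - recip_square_sum 0 k)"
proof -
  let ?n = "p - Suc r - k"
  have "recip_square_sum r ?n = (\<Sum>i<?n. 1 / of_nat (Suc r + (?n - Suc i)) ^ 2)"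
    unfolding recip_square_sum_def by (rule sum.nat_diff_reindex[symmetric])
  also have "\<dots> = (\<Sum>i<?n. 1 / of_nat (p - (Suc k + i)) ^ 2)"
    using assms by (intro sum.cong refl) (simp add: diff_diff_add[symmetric])
  finally have 1: "recip_square_sum r ?n = (\<Sum>i<?n. 1 / of_nat (p - (Suc k + i)) ^ 2)" .
  have 2: "recip_square_sum 0 (p - Suc r) - recip_square_sum 0 k = recip_square_sum k ?n"
    using recip_square_sum_eq_diff[of k ?n] assms by simp
  show ?thesis
    unfolding 1 2 recip_square_sum_def[of k]
  proof (rule p_integral_cong_sum[OF prime])
    fix i assume i: "i \<in> {..<?n}"
    define j where "j = Suc k + i"
    have j: "0 < j" "j < p" using i unfolding j_def by auto
    have pj: "rat_of_nat (p - j) = of_nat p - of_nat j" "rat_of_nat (p - j) \<noteq> 0"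
      using j by (simp_all add: of_nat_diff)
    have int: "p_integral p (1 / of_nat (p - j))" "p_integral p (1 / of_nat j)"
      using j by (intro p_integral_divide_nat[OF prime] p_integral_1[OF prime]; simp)+
    \<comment> \<open>This is 1/(p - j) + 1/j = p / (j (p - j)).\<close>
    have "1 / of_nat (p - j) = - (1 / of_nat j) + of_nat p ^ 1 * (1 / of_nat (p - j) * (1 / rat_of_nat j))"
      using pj(2) j unfolding pj(1) by (simp add: field_simps)
    then have "p_integral_cong p 1 (1 / of_nat (p - j)) (- (1 / of_nat j))"
      unfolding p_integral_cong_iff[OF prime] using p_integral_mult[OF prime int] by blast
    then have "p_integral_cong p 1 ((1 / of_nat (p - j)) ^ 2) ((- (1 / of_nat j)) ^ 2)"
      using int by (intro p_integral_cong_power[OF prime] p_integral_minus[OF prime])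
    then show "p_integral_cong p 1 (1 / of_nat (p - (Suc k + i)) ^ 2) (1 / of_nat (Suc k + i) ^ 2)"
      unfolding j_def by (simp add: power_divide)
  qed
qed

section \<open>Expansion of m-th powers modulo p^3\<close>

lemma one_minus_power_expansion:
  assumes "p_integral p y"
  shows "\<exists>s. p_integral p s \<and> (1 - of_nat p * y) ^ n
    = 1 - of_nat n * of_nat p * y + of_nat (n choose 2) * of_nat p ^ 2 * y ^ 2 + of_nat p ^ 3 * s"
proof (induction n)
  case 0
  then show ?case by (intro exI[of _ 0]) (simp add: prime)
next
  case (Suc n)
  then obtain s where s: "p_integral p s" "(1 - of_nat p * y) ^ n
    = 1 - of_nat n * of_nat p * y + of_nat (n choose 2) * of_nat p ^ 2 * y ^ 2 + of_nat p ^ 3 * s"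
    by blast
  \<comment> \<open>The contributions of order p^3 and higher after multiplying the expansion by 1 -
    p y.\<close>
  let ?t = "s - of_nat (n choose 2) * y ^ 3 - s * of_nat p * y"
  have "p_integral p ?t"
    using s(1) assms
    by (intro p_integral_diff[OF prime] p_integral_mult[OF prime] p_integral_power[OF prime]
        p_integral_of_nat[OF prime])
  moreover have "(1 - of_nat p * y) ^ Suc n = 1 - of_nat (Suc n) * of_nat p * y
      + of_nat (Suc n choose 2) * of_nat p ^ 2 * y ^ 2 + of_nat p ^ 3 * ?t"
    unfolding power_Suc s(2)
    by (simp add: numeral_2_eq_2 numeral_3_eq_3 algebra_simps)
  ultimately show ?case by blast
qed

text \<open>Dividing p by m makes the linear term of each m-th power exactly p/(r + 1 + i). The
  quadratic terms carry p^2 already, so all other factors may be replaced by 1 there and the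
  quadratic terms simply add up.\<close>

lemma prod_power_expansion:
  assumes "0 < m" "m < p" "r + k < p"
  shows "\<exists>s. p_integral p s \<and> (\<Prod>i<k. 1 - of_nat p / (of_nat m * of_nat (Suc r + i))) ^ m
    = (\<Prod>i<k. 1 - of_nat p / of_nat (Suc r + i))
      + of_nat p ^ 2 * (of_nat (m choose 2) / of_nat m ^ 2) * recip_square_sum r k + of_nat p ^ 3 * s"
  using assms(3)
proof (induction k)
  case 0
  then show ?case by (intro exI[of _ 0]) (simp add: prime recip_square_sum_def)
next
  case (Suc k)
  define P where "P = rat_of_nat p"
  define B where "B = (\<Prod>i<k. 1 - P / of_nat (Suc r + i))"
  define A where "A = (\<Prod>i<k. 1 - P / (of_nat m * of_nat (Suc r + i)))"
  define H where "H = recip_square_sum r k"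
  define c where "c = rat_of_nat (m choose 2) / of_nat m ^ 2"
  define w where "w = 1 / rat_of_nat (Suc r + k)"
  have w: "p_integral p w"
    unfolding w_def using Suc.prems
    by (intro p_integral_divide_nat[OF prime] p_integral_1[OF prime]) simp_all
  have P: "p_integral p P" unfolding P_def by (rule p_integral_of_nat[OF prime])
  have H: "p_integral p H"
    unfolding H_def using Suc.prems by (intro p_integral_recip_square_sum) simp
  have c: "p_integral p c"
  proof -
    have "p_integral p (of_nat (m choose 2) / of_nat m / of_nat m)"
      using assms by (intro p_integral_divide_nat[OF prime] p_integral_of_nat[OF prime])
    then show ?thesis by (simp add: c_def power2_eq_square)
  qed
  obtain b where b: "p_integral p b" "B = 1 + P * b"
    using falling_prod_cong_1(1)[of r k] Suc.prems
    unfolding p_integral_cong_iff[OF prime] B_def P_def by auto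
  have B: "p_integral p B"
    using falling_prod_cong_1(2)[of r k] Suc.prems unfolding B_def P_def by simp
  obtain s where s: "p_integral p s" "A ^ m = B + P ^ 2 * c * H + P ^ 3 * s"
    using Suc unfolding A_def B_def P_def c_def H_def by auto
  define y where "y = w / of_nat m"
  have "p_integral p y"
    unfolding y_def using w assms by (intro p_integral_divide_nat[OF prime])
  then obtain t where t: "p_integral p t" "(1 - P * y) ^ m
      = 1 - of_nat m * P * y + of_nat (m choose 2) * P ^ 2 * y ^ 2 + P ^ 3 * t"
    using one_minus_power_expansion unfolding P_def by blast
  have "of_nat m * P * y = P * w" "of_nat (m choose 2) * P ^ 2 * y ^ 2 = c * P ^ 2 * w ^ 2"
    using assms by (simp_all add: y_def c_def power_divide)
  then have F: "(1 - P * y) ^ m = 1 - P * w + c * P ^ 2 * w ^ 2 + P ^ 3 * t"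
    using t(2) by (simp only:)
  \<comment> \<open>The first summand is the error of replacing \<open>B\<close> by 1 in the
    quadratic term; the others collect the remaining products divisible by
    \<open>P ^ 3\<close>.\<close>
  let ?s = "c * b * w ^ 2 + c * H * (c * P * w ^ 2 + P ^ 2 * t - w)
    + s * (1 - P * w + c * P ^ 2 * w ^ 2 + P ^ 3 * t) + B * t"
  have "p_integral p ?s"
    using w P H c b(1) B s(1) t(1)
    by (intro p_integral_add[OF prime] p_integral_diff[OF prime] p_integral_mult[OF prime]
        p_integral_power[OF prime] p_integral_1[OF prime])
  moreover have "(A * (1 - P * y)) ^ m = B * (1 - P * w) + P ^ 2 * c * (H + w ^ 2) + P ^ 3 * ?s"
  proof -
    have "B * (c * P ^ 2 * w ^ 2) = c * P ^ 2 * w ^ 2 + P ^ 3 * (c * b * w ^ 2)"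
      unfolding b(2) by (simp add: power2_eq_square power3_eq_cube algebra_simps)
    then show ?thesis
      unfolding power_mult_distrib s(2) F by (simp add: power2_eq_square power3_eq_cube algebra_simps)
  qed
  moreover have "A * (1 - P * y) = (\<Prod>i<Suc k. 1 - P / (of_nat m * of_nat (Suc r + i)))"
    "B * (1 - P * w) = (\<Prod>i<Suc k. 1 - P / of_nat (Suc r + i))"
    "H + w ^ 2 = recip_square_sum r (Suc k)"
    by (simp_all add: A_def B_def y_def w_def H_def recip_square_sum_def power_divide mult.commute)
  ultimately show ?case unfolding P_def c_def by metis
qed

section \<open>The second-order sum modulo p\<close>

lemma binomial_power_recip_square_sum_cong_0:
  assumes m: "2 < m" and even: "even (r * m)" and p: "m * Suc r < p"
  shows "p_integral_cong p 1
    (\<Sum>k\<le>p - Suc r. of_nat (k + r choose r) ^ m * recip_square_sum r k) 0"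
proof -
  define N where "N = p - Suc r"
  define b where "b = (\<lambda>k. rat_of_nat (k + r choose r))"
  define W where "W = (\<Sum>k\<le>N. b k ^ m * recip_square_sum r k)"
  define C where "C = recip_square_sum 0 N - recip_square_sum 0 r"
  \<comment> \<open>Chosen so that b k * h(k) is \<open>b k ^ m\<close> times
    \<open>recip_square_sum r k\<close> plus its reflected value modulo p. The exponent m - 3 leaves
    two factors for the squared cofactor and one for the weight b k.\<close>
  define h where "h = smult C (binom_poly r ^ (m - 1))
    + (\<Sum>i<r. binom_poly r ^ (m - 3) * binom_poly_cofactor r i ^ 2)"
  have "Suc r \<le> m * Suc r" using m mult_le_mono1[of 1 m "Suc r"] by simp
  then have r: "r < p" using p by simp
  have deg: "degree h < N"
  proof -
    have "(m - 3) * r + 2 * r = (m - 1) * r"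
    proof -
      have "m - 1 = (m - 3) + 2" using m by simp
      then show ?thesis by (simp only: add_mult_distrib)
    qed
    have "degree (binom_poly r ^ n) \<le> n * r" for n
      using degree_power_le[of "binom_poly r" n] degree_binom_poly[of r]
      by (metis le_trans mult.commute mult_le_mono1)
    moreover have "degree (binom_poly_cofactor r i ^ 2) \<le> 2 * r" for i
      using degree_power_le[of "binom_poly_cofactor r i" 2] degree_binom_poly_cofactor[of r i]
      by (metis le_trans mult.commute mult_le_mono1)
    ultimately have "degree (binom_poly r ^ (m - 3)) + degree (binom_poly_cofactor r i ^ 2) \<le> (m - 1) * r" for i
      unfolding \<open>(m - 3) * r + 2 * r = (m - 1) * r\<close>[symmetric] by (rule add_mono)
    with degree_mult_le have "degree (binom_poly r ^ (m - 3) * binom_poly_cofactor r i ^ 2) \<le> (m - 1) * r" for i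
      by (rule order.trans)
    then have "degree (\<Sum>i<r. binom_poly r ^ (m - 3) * binom_poly_cofactor r i ^ 2) \<le> (m - 1) * r"
      by (intro degree_sum_le) simp_all
    moreover have "degree (smult C (binom_poly r ^ (m - 1))) \<le> (m - 1) * r"
      using degree_smult_le \<open>\<And>n. degree (binom_poly r ^ n) \<le> n * r\<close> by (rule order.trans)
    ultimately have "degree h \<le> (m - 1) * r"
      unfolding h_def by (intro degree_add_le)
    also have "(m - 1) * r + Suc r < p"
    proof -
      have "(m - 1) * r + Suc r = Suc (m * r)"
        using m by (cases m) simp_all
      also have "\<dots> < p" using p m by simp
      finally show ?thesis .
    qed
    then have "(m - 1) * r < N" by (simp add: N_def)
    finally show ?thesis .
  qed
  have C: "p_integral p C"
    unfolding C_def using r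
    by (intro p_integral_diff[OF prime] p_integral_recip_square_sum) (simp_all add: N_def)
  have int_b: "p_integral p (b k)" for k
    unfolding b_def by (rule p_integral_of_nat[OF prime])
  have int_H: "p_integral p (recip_square_sum r k)" if "k \<le> N" for k
    using that r by (intro p_integral_recip_square_sum) (simp add: N_def)
  have h_eq: "poly h (of_nat k)
    = C * b k ^ (m - 1) + (\<Sum>i<r. b k ^ (m - 3) * (b k / of_nat (k + Suc i)) ^ 2)" for k
    unfolding h_def b_def
    by (simp add: poly_sum poly_power poly_binom_poly poly_binom_poly_cofactor
        del: of_nat_add of_nat_Suc)
  have int_h: "p_integral p (poly h (of_nat k))" if "k \<le> N" for k
    unfolding h_eq using that r N_def C int_b
    by (intro p_integral_add[OF prime] p_integral_mult[OF prime] p_integral_sum[OF prime]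
        p_integral_power[OF prime] p_integral_divide_nat[OF prime]) auto
  have bh: "b k * poly h (of_nat k)
    = b k ^ m * (recip_square_sum r k + (recip_square_sum 0 N - recip_square_sum 0 k))" for k
  proof -
    have m1: "b k * b k ^ (m - 1) = b k ^ m"
      using m by (metis power_minus_mult mult.commute gr_implies_not0 not_gr_zero)
    have "b k * (b k ^ (m - 3) * b k ^ 2) = b k ^ Suc (m - 3 + 2)"
      by (simp only: power_Suc power_add)
    also have "Suc (m - 3 + 2) = m" using m by simp
    finally have m3: "b k * (b k ^ (m - 3) * b k ^ 2) = b k ^ m" .
    have "b k * poly h (of_nat k)
      = C * (b k * b k ^ (m - 1)) + b k * (b k ^ (m - 3) * b k ^ 2) * (\<Sum>i<r. 1 / of_nat (k + Suc i) ^ 2)"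
      unfolding h_eq by (simp add: distrib_left sum_distrib_left power_divide mult.assoc mult.left_commute
          del: of_nat_add of_nat_Suc)
    \<comment> \<open>The same kind of segment with r and k exchanged; after writing both segments
      as harmonic differences, the terms at offset r cancel against \<open>C\<close>.\<close>
    also have "(\<Sum>i<r. 1 / rat_of_nat (k + Suc i) ^ 2) = recip_square_sum k r"
      by (simp add: recip_square_sum_def)
    also have "\<dots> = recip_square_sum 0 (r + k) - recip_square_sum 0 k"
      using recip_square_sum_eq_diff[of k r] by (simp add: add.commute)
    finally show ?thesis
      unfolding m1 m3 C_def recip_square_sum_eq_diff[of r k] by (simp add: algebra_simps)
  qed
  have refl: "W = (\<Sum>k\<le>N. b (N - k) ^ m * recip_square_sum r (N - k))"
    unfolding W_def by (rule sum.reindex_bij_witness[of _ "\<lambda>k. N - k" "\<lambda>k. N - k"]) auto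
  have "p_integral_cong p 1 W
    (\<Sum>k\<le>N. b k ^ m * (recip_square_sum 0 N - recip_square_sum 0 k))"
    unfolding refl
  proof (rule p_integral_cong_sum[OF prime])
    fix k assume "k \<in> {..N}"
    then have k: "k \<le> p - Suc r" by (simp add: N_def)
    have int_mb: "p_integral p ((- 1) ^ r * b k)"
      using int_b by (intro p_integral_mult[OF prime] p_integral_power[OF prime] p_integral_minus[OF prime]
          p_integral_1[OF prime])
    have "p_integral_cong p 1 (b (N - k) ^ m) (((- 1) ^ r * b k) ^ m)"
      unfolding b_def N_def
      using int_b int_mb binomial_reflect_cong[OF r k]
      by (intro p_integral_cong_power[OF prime]) (simp_all add: b_def)
    \<comment> \<open>The parity hypothesis enters here: the sign is (-1)^(r m).\<close>
    also have "((- 1) ^ r * b k) ^ m = b k ^ m"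
      using even by (simp add: power_mult_distrib flip: power_mult)
    finally show "p_integral_cong p 1 (b (N - k) ^ m * recip_square_sum r (N - k))
      (b k ^ m * (recip_square_sum 0 N - recip_square_sum 0 k))"
      using recip_square_sum_reflect_cong[OF r k] k r int_b
      by (intro p_integral_cong_mult[OF prime] p_integral_power[OF prime] p_integral_diff[OF prime]
          p_integral_recip_square_sum) (simp_all add: N_def)
  qed
  then have "p_integral_cong p 1 (W + W)
    (W + (\<Sum>k\<le>N. b k ^ m * (recip_square_sum 0 N - recip_square_sum 0 k)))"
    by (intro p_integral_cong_add[OF prime] p_integral_cong_refl[OF prime])
  also have "W + (\<Sum>k\<le>N. b k ^ m * (recip_square_sum 0 N - recip_square_sum 0 k))
    = (\<Sum>k\<le>N. b k * poly h (of_nat k))"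
    unfolding bh W_def by (simp add: distrib_left sum.distrib)
  finally have "p_integral_cong p 1 (W + W) 0"
    using binomial_weighted_poly_sum_cong_0[OF r deg[unfolded N_def]] int_h
    unfolding b_def N_def by (blast intro: p_integral_cong_trans[OF prime])
  then obtain s where s: "p_integral p s" "W + W = of_nat p * s"
    unfolding p_integral_cong_iff[OF prime] by auto
  \<comment> \<open>Reflection only shows that 2 W vanishes modulo p; since p > 2, halving preserves
    integrality.\<close>
  have "2 < p" using m p \<open>Suc r \<le> m * Suc r\<close> by (metis le_add1 less_trans less_le_trans mult_Suc_right)
  then have "p_integral p (s / of_nat 2)"
    using s(1) by (intro p_integral_divide_nat[OF prime]) simp_all
  moreover have "W = of_nat p * (s / of_nat 2)" using s(2) by simp
  ultimately show ?thesis
    unfolding p_integral_cong_iff[OF prime] W_def b_def N_def by auto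
qed

end

section \<open>Assembly of the congruence modulo p^3\<close>

lemma gbinomial_neg_prod:
  "(- 1) ^ k * (x gchoose k) = (\<Prod>i<k. (of_nat i - x) / of_nat (Suc i) :: rat)"
proof -
  have "(- 1) ^ k * (\<Prod>i<k. x - of_nat i) = (\<Prod>i<k. of_nat i - x)"
    by (induction k) (simp_all add: algebra_simps)
  then show ?thesis
    by (simp add: gbinomial_prod_rev atLeast0LessThan prod_dividef fact_eq_prod_lessThan del: of_nat_Suc)
qed

theorem theorem1p2:
  fixes m q p :: nat
  assumes "m > 2" and "q > 0"
    and "even m \<or> odd q"
    and "prime p" and "p > m * q"
  shows "p_integral_cong p 3
           (\<Sum>k = 0..p - 1. (- 1) ^ (k * m) * (((of_nat p / of_nat m - of_nat q :: rat) gchoose k) ^ m)) 0"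
proof -
  note prime = \<open>prime p\<close>
  obtain r where q: "q = Suc r" using assms(2) gr0_implies_Suc by blast
  define N where "N = p - Suc r"
  define x where "x = (of_nat p / of_nat m - of_nat q :: rat)"
  \<comment> \<open>Absorbing the sign turns each summand into \<open>u k ^ m\<close> and makes the
    numerators of the product q + i - p/m.\<close>
  define u where "u = (\<lambda>k. (- 1) ^ k * (x gchoose k))"
  define b where "b = (\<lambda>k. rat_of_nat (k + r choose r))"
  define B where "B = (\<lambda>k. \<Prod>i<k. 1 - of_nat p / rat_of_nat (Suc r + i))"
  define c where "c = rat_of_nat (m choose 2) / of_nat m ^ 2"
  have "Suc r \<le> m * Suc r" "m \<le> m * Suc r"
    using assms(1) mult_le_mono1[of 1 m "Suc r"] by simp_all
  then have r: "Suc r < p" "m < p" using assms(5) unfolding q by linarith+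
  have int_m: "p_integral p (a / of_nat m)" if "p_integral p a" for a
    using that assms(1) r by (intro p_integral_divide_nat[OF prime]) simp_all
  have u_prod: "u k = (\<Prod>i<k. (of_nat (Suc r + i) - of_nat p / of_nat m) / of_nat (Suc i))" for k
    unfolding u_def gbinomial_neg_prod by (intro prod.cong refl) (simp add: x_def q algebra_simps)
  have tail: "p_integral_cong p 3 (u k ^ m) 0" if k: "N < k" "k < p" for k
  proof -
    let ?f = "\<lambda>i. (rat_of_nat (Suc r + i) - of_nat p / of_nat m) / of_nat (Suc i)"
    have int: "p_integral p (?f i)" if "i < k" for i
      using that k
      by (intro p_integral_divide_nat[OF prime] p_integral_diff[OF prime] p_integral_of_nat[OF prime] int_m)
        simp_all
    \<comment> \<open>The factor with index N has numerator p - p/m = p (1 - 1/m), and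
      \<open>v\<close> is what remains of \<open>u k\<close> without this p. Since m > 2, the m-th
      power contains p^3.\<close>
    define v where "v = (1 - 1 / of_nat m) / of_nat (Suc N) * (\<Prod>i\<in>{..<k} - {N}. ?f i)"
    have "p_integral p ((1 - 1 / of_nat m) / of_nat (Suc N))"
      using k assms(1) r
      by (intro p_integral_divide_nat[OF prime] p_integral_diff[OF prime] p_integral_1[OF prime])
        simp_all
    moreover have "p_integral p (\<Prod>i\<in>{..<k} - {N}. ?f i)"
      using int by (intro p_integral_prod[OF prime]) simp
    ultimately have "p_integral p v"
      unfolding v_def by (rule p_integral_mult[OF prime])
    have "u k = ?f N * (\<Prod>i\<in>{..<k} - {N}. ?f i)"
      unfolding u_prod using k by (intro prod.remove) auto
    also have "Suc r + N = p" using r by (simp add: N_def)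
    finally have "u k = of_nat p * v"
      by (simp add: v_def algebra_simps diff_divide_distrib)
    then have "u k ^ m = of_nat p ^ (3 + (m - 3)) * v ^ m"
      using assms(1) by (simp add: power_mult_distrib)
    then have "u k ^ m = 0 + of_nat p ^ 3 * (of_nat p ^ (m - 3) * v ^ m)"
      by (simp only: power_add mult.assoc add_0_left)
    moreover have "p_integral p (of_nat p ^ (m - 3) * v ^ m)"
      using \<open>p_integral p v\<close>
      by (intro p_integral_mult[OF prime] p_integral_power[OF prime] p_integral_of_nat[OF prime])
    ultimately show ?thesis unfolding p_integral_cong_iff[OF prime] by blast
  qed
  have head: "p_integral_cong p 3 (u k ^ m)
      (b k ^ m * B k + of_nat p ^ 2 * c * (b k ^ m * recip_square_sum r k))" if k: "k \<le> N" for k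
  proof -
    have "0 < m" "r + k < p" using assms(1) k r by (auto simp: N_def)
    then obtain s where s: "p_integral p s"
      "(\<Prod>i<k. 1 - of_nat p / (of_nat m * of_nat (Suc r + i))) ^ m
        = B k + of_nat p ^ 2 * c * recip_square_sum r k + of_nat p ^ 3 * s"
      using prod_power_expansion[OF prime, of m r k] r unfolding B_def c_def by blast
    \<comment> \<open>Each factor splits as (r + 1 + i)/(i + 1) times 1 - p/(m (r + 1 + i)).\<close>
    have "u k = b k * (\<Prod>i<k. 1 - of_nat p / (of_nat m * of_nat (Suc r + i)))"
      unfolding u_prod b_def binomial_prod_left prod.distrib[symmetric]
      using assms(1) by (intro prod.cong refl) (simp add: divide_simps del: of_nat_Suc of_nat_add)
    then have "u k ^ m = b k ^ m * B k + of_nat p ^ 2 * c * (b k ^ m * recip_square_sum r k)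
        + of_nat p ^ 3 * (b k ^ m * s)"
      by (simp only: power_mult_distrib s(2)) (simp add: algebra_simps)
    moreover have "p_integral p (b k ^ m * s)"
      unfolding b_def using s(1)
      by (intro p_integral_mult[OF prime] p_integral_power[OF prime] p_integral_of_nat[OF prime])
    ultimately show ?thesis unfolding p_integral_cong_iff[OF prime] by blast
  qed
  \<comment> \<open>One of the m factors \<open>b k\<close> combines with \<open>B k\<close> into a
    signed binomial coefficient; the other m - 1 form the polynomial that is differenced, so the sum
    is exactly 0.\<close>
  have main: "(\<Sum>k\<le>N. b k ^ m * B k) = 0"
  proof -
    have "(m - 1) * r + Suc r = Suc (m * r)"
      using assms(1) by (cases m) simp_all
    also have "\<dots> < p" using assms(1,5) q by simp
    finally have "(m - 1) * r < N" by (simp add: N_def)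
    moreover have "degree (binom_poly r ^ (m - 1)) \<le> (m - 1) * r"
      using degree_power_le[of "binom_poly r" "m - 1"] degree_binom_poly[of r]
      by (metis le_trans mult.commute mult_le_mono1)
    ultimately have "(\<Sum>k\<le>N. (- 1) ^ k * of_nat (N choose k) * poly (binom_poly r ^ (m - 1)) (of_nat k)) = 0"
      by (intro alternating_binomial_sum_poly_eq_0) simp
    moreover have "b k ^ m * B k
      = (- 1) ^ k * of_nat (N choose k) * poly (binom_poly r ^ (m - 1)) (of_nat k)" for k
    proof -
      have "b k ^ m = b k * b k ^ (m - 1)"
        using assms(1) by (metis power_minus_mult mult.commute gr_implies_not0 not_gr_zero)
      then show ?thesis
        using binomial_times_falling_prod[of r p k] r
        by (simp add: b_def B_def N_def poly_power poly_binom_poly mult_ac del: of_nat_add of_nat_Suc)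
    qed
    ultimately show ?thesis by simp
  qed
  have "even (r * m)" using assms(3) q by auto
  then obtain s where s: "p_integral p s"
    "(\<Sum>k\<le>N. b k ^ m * recip_square_sum r k) = of_nat p * s"
    using binomial_power_recip_square_sum_cong_0[OF prime assms(1), of r] assms(5)
    unfolding p_integral_cong_iff[OF prime] b_def N_def q by auto
  have "p_integral p (c * s)"
  proof -
    have "p_integral p (of_nat (m choose 2) / of_nat m / of_nat m)"
      by (intro int_m p_integral_of_nat[OF prime])
    then show ?thesis
      using s(1) by (intro p_integral_mult[OF prime]) (simp_all add: c_def power2_eq_square)
  qed
  moreover have "(\<Sum>k\<le>N. b k ^ m * B k + of_nat p ^ 2 * c * (b k ^ m * recip_square_sum r k))
    = 0 + of_nat p ^ 3 * (c * s)"
    unfolding sum.distrib main sum_distrib_left[symmetric] s(2)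
    by (simp add: power2_eq_square power3_eq_cube)
  ultimately have "p_integral_cong p 3
      (\<Sum>k\<le>N. b k ^ m * B k + of_nat p ^ 2 * c * (b k ^ m * recip_square_sum r k)) 0"
    unfolding p_integral_cong_iff[OF prime] by blast
  then have "p_integral_cong p 3 (\<Sum>k\<le>N. u k ^ m) 0"
    using head by (intro p_integral_cong_trans[OF prime _ \<open>p_integral_cong p 3 _ 0\<close>]
        p_integral_cong_sum[OF prime]) simp
  moreover have "p_integral_cong p 3 (\<Sum>k\<in>{N<..<p}. u k ^ m) (\<Sum>k\<in>{N<..<p}. 0)"
    using tail by (intro p_integral_cong_sum[OF prime]) simp
  ultimately have "p_integral_cong p 3 ((\<Sum>k\<le>N. u k ^ m) + (\<Sum>k\<in>{N<..<p}. u k ^ m)) (0 + (\<Sum>k\<in>{N<..<p}. 0))"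
    by (rule p_integral_cong_add[OF prime])
  moreover have "{0..p - 1} = {..N} \<union> {N<..<p}" using r by (auto simp: N_def)
  then have "(\<Sum>k = 0..p - 1. u k ^ m) = (\<Sum>k\<le>N. u k ^ m) + (\<Sum>k\<in>{N<..<p}. u k ^ m)"
    by (simp add: sum.union_disjoint disjoint_iff)
  ultimately have "p_integral_cong p 3 (\<Sum>k = 0..p - 1. u k ^ m) 0" by simp
  then show ?thesis
    by (simp add: u_def x_def power_mult_distrib power_mult)
qed

end
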